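(* Let $1<p<\infty$, $1\le q<\infty$, and let $T\colon\ell_p\to\ell_q$ be a bounded linear operator (between real sequence spaces) that is monotone with respect to non-increasing permutation. Assume that for some $\epsilon>0$ the operator $T$ is continuous from the $\ell_{p+\epsilon}$-norm into $\ell_q$, i.e. there is a constant $C$ such that $\|T(x)\|_{\ell_q}\le C\|x\|_{\ell_{p+\epsilon}}$ for all $x\in\ell_p$ (equivalently, $T$ extends to a bounded linear operator $\ell_{p+\epsilon}\to\ell_q$). Then $T$ attains its norm, i.e. there exists $v\in\ell_p$ with $\|v\|_{\ell_p}=1$ and $\|T(v)\|_{\ell_q}=\|T\|$.
   Context: Here $\ell_p$ denotes the Banach space of $p$-summable real sequences indexed by $\mathbb{N}=\{1,2,\dots\}$, and $\|T\|=\sup\{\|T(x)\|_{\ell_q}:\|x\|_{\ell_p}=1\}$. For a real sequence $\alpha=(\alpha_j)_{j\ge1}\in c_0$, the non-increasing permutation $\sigma(\alpha)=(\beta_j)_{j\ge1}$ is the non-increasing rearrangement of $(|\alpha_j|)_j$ counted with multiplicity: $\beta_1=\max_j|\alpha_j|$, $\beta_2$ is the largest of the remaining absolute values once one index realizing $\beta_1$ has been removed, and so on; explicitly, $\beta_k=\min\{\max_{j\notin F}|\alpha_j| : F\subset\mathbb{N},\ |F|=k-1\}$. In particular $\|\sigma(x)\|_{\ell_p}=\|x\|_{\ell_p}$ for $x\in\ell_p$. A linear operator $T\colon\ell_p\to\ell_q$ is monotone with respect to non-increasing permutation if $\|T(\sigma(x))\|_{\ell_q}\ge\|T(x)\|_{\ell_q}$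 for every $x\in\ell_p$. *)

theory Defs imports Complex_Main begin

text \<open>Sequences are functions \<^typ>\<open>nat \<Rightarrow> real\<close> indexed from 0; the entry with index \<open>n\<close> here is
  the entry with index \<open>n + 1\<close> of a sequence indexed by the positive integers.\<close>

definition ell :: "real \<Rightarrow> (nat \<Rightarrow> real) set" where
  "ell p = {x. summable (\<lambda>n. \<bar>x n\<bar> powr p)}"

definition ell_norm :: "real \<Rightarrow> (nat \<Rightarrow> real) \<Rightarrow> real" where
  "ell_norm p x = (\<Sum>n. \<bar>x n\<bar> powr p) powr (1 / p)"

text \<open>Operators are total functions on sequences, of which only the restriction to \<^term>\<open>ell p\<close>
  is meaningful.\<close>

definition ell_linear :: "real \<Rightarrow> real \<Rightarrow> ((nat \<Rightarrow> real) \<Rightarrow> (nat \<Rightarrow> real)) \<Rightarrow> bool" where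
  "ell_linear p q T \<longleftrightarrow>
     (\<forall>x\<in>ell p. T x \<in> ell q) \<and>
     (\<forall>x\<in>ell p. \<forall>y\<in>ell p. T (\<lambda>n. x n + y n) = (\<lambda>n. T x n + T y n)) \<and>
     (\<forall>c. \<forall>x\<in>ell p. T (\<lambda>n. c * x n) = (\<lambda>n. c * T x n))"

definition ell_bounded_linear ::
  "real \<Rightarrow> real \<Rightarrow> ((nat \<Rightarrow> real) \<Rightarrow> (nat \<Rightarrow> real)) \<Rightarrow> bool" where
  "ell_bounded_linear p q T \<longleftrightarrow>
     ell_linear p q T \<and> (\<exists>C. \<forall>x\<in>ell p. ell_norm q (T x) \<le> C * ell_norm p x)"

definition op_norm :: "real \<Rightarrow> real \<Rightarrow> ((nat \<Rightarrow> real) \<Rightarrow> (nat \<Rightarrow> real)) \<Rightarrow> real" where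
  "op_norm p q T = Sup {ell_norm q (T x) |x. x \<in> ell p \<and> ell_norm p x = 1}"

text \<open>With indices starting at 0, the entry with index \<open>k\<close> is obtained by removing \<open>k\<close> indices.
  The supremum and the infimum are a maximum and a minimum for null sequences, see
  \<open>sup_compl_attained\<close> and \<open>noninc_perm_attained\<close> below.\<close>

definition noninc_perm :: "(nat \<Rightarrow> real) \<Rightarrow> nat \<Rightarrow> real" where
  "noninc_perm \<alpha> k = (INF F\<in>{F. finite F \<and> card F = k}. SUP j\<in>- F. \<bar>\<alpha> j\<bar>)"

definition perm_monotone :: "real \<Rightarrow> real \<Rightarrow> ((nat \<Rightarrow> real) \<Rightarrow> (nat \<Rightarrow> real)) \<Rightarrow> bool" where
  "perm_monotone p q T \<longleftrightarrow>
     (\<forall>x\<in>ell p. ell_norm q (T (noninc_perm x)) \<ge> ell_norm q (T x))"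

lemma null_seq_max_exists:
  fixes \<alpha> :: "nat \<Rightarrow> real"
  assumes "\<alpha> \<longlonglongrightarrow> 0" and "finite F"
  shows "\<exists>i\<in>- F. \<forall>j\<in>- F. \<bar>\<alpha> j\<bar> \<le> \<bar>\<alpha> i\<bar>"
proof (cases "\<forall>j\<in>- F. \<alpha> j = 0")
  case True
  moreover have "- F \<noteq> {}"
    using assms(2) by (metis Compl_empty_eq double_compl infinite_UNIV_nat)
  ultimately show ?thesis by auto
next
  case False
  then obtain a where a: "a \<in> - F" "\<alpha> a \<noteq> 0" by auto
  then obtain N where N: "\<And>n. n \<ge> N \<Longrightarrow> \<bar>\<alpha> n\<bar> < \<bar>\<alpha> a\<bar>"
    using LIMSEQ_D[OF assms(1), of "\<bar>\<alpha> a\<bar>"] by auto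
  define B where "B = {..<N} - F"
  have aB: "a \<in> B" using a N[of a] by (auto simp: B_def not_less[symmetric])
  have fin: "finite ((\<lambda>j. \<bar>\<alpha> j\<bar>) ` B)" by (simp add: B_def)
  have "Max ((\<lambda>j. \<bar>\<alpha> j\<bar>) ` B) \<in> (\<lambda>j. \<bar>\<alpha> j\<bar>) ` B"
    using Max_in[OF fin] aB by blast
  then obtain i where i: "i \<in> B" "\<bar>\<alpha> i\<bar> = Max ((\<lambda>j. \<bar>\<alpha> j\<bar>) ` B)" by auto
  have le: "\<bar>\<alpha> j\<bar> \<le> \<bar>\<alpha> i\<bar>" if "j \<in> B" for j
    using Max_ge[OF fin] that i(2) by simp
  have "\<bar>\<alpha> j\<bar> \<le> \<bar>\<alpha> i\<bar>" if "j \<in> - F" for j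
  proof (cases "j < N")
    case True
    then show ?thesis using that le by (simp add: B_def)
  next
    case False
    then show ?thesis using N[of j] le[OF aB] by simp
  qed
  then show ?thesis using i(1) by (auto simp: B_def)
qed

lemma sup_compl_attained:
  fixes \<alpha> :: "nat \<Rightarrow> real"
  assumes "\<alpha> \<longlonglongrightarrow> 0" and "finite F"
  shows "\<exists>i\<in>- F. (SUP j\<in>- F. \<bar>\<alpha> j\<bar>) = \<bar>\<alpha> i\<bar> \<and> (\<forall>j\<in>- F. \<bar>\<alpha> j\<bar> \<le> \<bar>\<alpha> i\<bar>)"
proof -
  obtain i where i: "i \<in> - F" "\<forall>j\<in>- F. \<bar>\<alpha> j\<bar> \<le> \<bar>\<alpha> i\<bar>"
    using null_seq_max_exists[OF assms] by blast
  have "(SUP j\<in>- F. \<bar>\<alpha> j\<bar>) = \<bar>\<alpha> i\<bar>"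
    by (rule cSup_eq_maximum) (use i in auto)
  then show ?thesis using i by blast
qed

lemma largest_entries_exist:
  fixes \<alpha> :: "nat \<Rightarrow> real"
  assumes "\<alpha> \<longlonglongrightarrow> 0"
  shows "\<exists>F. finite F \<and> card F = k \<and> (\<forall>i\<in>F. \<forall>j\<in>- F. \<bar>\<alpha> j\<bar> \<le> \<bar>\<alpha> i\<bar>)"
proof (induction k)
  case 0
  show ?case by (intro exI[of _ "{}"]) simp
next
  case (Suc k)
  then obtain F where F: "finite F" "card F = k" "\<forall>i\<in>F. \<forall>j\<in>- F. \<bar>\<alpha> j\<bar> \<le> \<bar>\<alpha> i\<bar>" by blast
  obtain m where m: "m \<in> - F" "\<forall>j\<in>- F. \<bar>\<alpha> j\<bar> \<le> \<bar>\<alpha> m\<bar>"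
    using null_seq_max_exists[OF assms F(1)] by blast
  show ?case by (intro exI[of _ "insert m F"]) (use F m in auto)
qed

lemma noninc_perm_attained:
  fixes \<alpha> :: "nat \<Rightarrow> real"
  assumes "\<alpha> \<longlonglongrightarrow> 0"
  shows "\<exists>F. finite F \<and> card F = k \<and> noninc_perm \<alpha> k = (SUP j\<in>- F. \<bar>\<alpha> j\<bar>) \<and>
    (\<forall>G. finite G \<and> card G = k \<longrightarrow> noninc_perm \<alpha> k \<le> (SUP j\<in>- G. \<bar>\<alpha> j\<bar>))"
proof -
  obtain F where F: "finite F" "card F = k" "\<forall>i\<in>F. \<forall>j\<in>- F. \<bar>\<alpha> j\<bar> \<le> \<bar>\<alpha> i\<bar>"
    using largest_entries_exist[OF assms] by blast
  have min: "(SUP j\<in>- F. \<bar>\<alpha> j\<bar>) \<le> (SUP j\<in>- G. \<bar>\<alpha> j\<bar>)" if G: "finite G" "card G = k" for G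
  proof (cases "F \<subseteq> G")
    case True
    then have "F = G" using G F(2) by (simp add: card_subset_eq)
    then show ?thesis by simp
  next
    case False
    then obtain i where i: "i \<in> F" "i \<in> - G" by auto
    obtain a where a: "a \<in> - F" "(SUP j\<in>- F. \<bar>\<alpha> j\<bar>) = \<bar>\<alpha> a\<bar>"
      using sup_compl_attained[OF assms F(1)] by blast
    obtain b where b: "(SUP j\<in>- G. \<bar>\<alpha> j\<bar>) = \<bar>\<alpha> b\<bar>" "\<forall>j\<in>- G. \<bar>\<alpha> j\<bar> \<le> \<bar>\<alpha> b\<bar>"
      using sup_compl_attained[OF assms G(1)] by blast
    have "\<bar>\<alpha> a\<bar> \<le> \<bar>\<alpha> i\<bar>" using F(3) i a by blast
    also have "\<dots> \<le> \<bar>\<alpha> b\<bar>" using b i by blast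
    finally show ?thesis using a b by simp
  qed
  have "noninc_perm \<alpha> k = (SUP j\<in>- F. \<bar>\<alpha> j\<bar>)"
    unfolding noninc_perm_def
    by (rule cInf_eq_minimum) (use F min in auto)
  then show ?thesis using F min by auto
qed

end

theory Submission imports Defs "HOL-Complex_Analysis.Great_Picard" begin

text \<open>Rearranging a maximizing sequence keeps it maximizing, by monotonicity of \<open>T\<close>. A
  nonincreasing sequence \<open>y\<close> in the unit ball of \<open>\<ell>\<^sub>p\<close> satisfies \<open>y\<^sub>k \<le> k\<^bsup>-1/p\<^esup>\<close>, and the
  right-hand side lies in \<open>\<ell>\<^bsub>p+\<epsilon>\<^esub>\<close>. Hence a pointwise limit \<open>v\<close> of the rearranged sequence, which
  exists along a subsequence by a diagonal argument, is a limit in the \<open>\<ell>\<^bsub>p+\<epsilon>\<^esub>\<close>-norm by dominated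
  convergence, so that \<open>\<parallel>T v\<parallel> = \<parallel>T\<parallel>\<close>. Fatou's lemma gives \<open>\<parallel>v\<parallel> \<le> 1\<close>, and \<open>\<parallel>T v\<parallel> \<le> \<parallel>T\<parallel> \<parallel>v\<parallel>\<close> then
  forces \<open>\<parallel>v\<parallel> = 1\<close> unless \<open>T = 0\<close>.\<close>

subsection \<open>The sequence spaces\<close>

lemma ell_norm_nonneg: "0 \<le> ell_norm p x"
  by (simp add: ell_norm_def)

text \<open>Turns norm bounds into bounds on power sums. Membership in \<open>ell p\<close> makes
  the sum nonnegative, so that raising to the power \<open>p\<close> undoes the root.\<close>

lemma ell_norm_le_iff:
  assumes "0 < p" "0 \<le> A" "x \<in> ell p"
  shows "ell_norm p x \<le> A \<longleftrightarrow> (\<Sum>n. \<bar>x n\<bar> powr p) \<le> A powr p"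
proof -
  define S where "S = (\<Sum>n. \<bar>x n\<bar> powr p)"
  have S: "0 \<le> S"
    using assms(3) by (simp add: S_def ell_def suminf_nonneg)
  have "S powr (1/p) \<le> A \<longleftrightarrow> (S powr (1/p)) powr p \<le> A powr p"
    using assms by (metis linorder_not_le powr_ge_zero powr_less_mono2 powr_mono2 less_imp_le)
  then show ?thesis
    using S assms by (simp add: ell_norm_def S_def powr_powr)
qed

lemma ell_scale:
  assumes "x \<in> ell p"
  shows "(\<lambda>n. c * x n) \<in> ell p"
  using assms by (auto simp: ell_def abs_mult powr_mult intro: summable_mult)

lemma ell_norm_scale:
  assumes "0 < p" "x \<in> ell p"
  shows "ell_norm p (\<lambda>n. c * x n) = \<bar>c\<bar> * ell_norm p x"
proof -
  have "(\<Sum>n. \<bar>c * x n\<bar> powr p) = \<bar>c\<bar> powr p * (\<Sum>n. \<bar>x n\<bar> powr p)"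
    using assms by (auto simp: ell_def abs_mult powr_mult intro: suminf_mult)
  then show ?thesis
    using assms by (simp add: ell_norm_def powr_mult powr_powr suminf_nonneg ell_def)
qed

text \<open>Finite sums are what can be controlled both under rearrangement and under coordinatewise
  limits; the lemma serves both cases.\<close>

lemma ell_bounded_partial_sums:
  assumes p: "0 < p" and S: "\<And>K. (\<Sum>k<K. \<bar>x k\<bar> powr p) \<le> 1"
  shows "x \<in> ell p" "ell_norm p x \<le> 1"
proof -
  have sm: "summable (\<lambda>n. \<bar>x n\<bar> powr p)"
    using S by (intro bounded_imp_summable[where B=1]) (simp_all only: powr_ge_zero flip: lessThan_Suc_atMost)
  then show 1: "x \<in> ell p" by (simp add: ell_def)
  have "(\<Sum>n. \<bar>x n\<bar> powr p) \<le> 1"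
    using sm S by (intro suminf_le_const) auto
  then show "ell_norm p x \<le> 1"
    using ell_norm_le_iff[of p 1 x] p 1 by simp
qed

lemma ell_sum_le_one:
  assumes "0 < p" "x \<in> ell p" "ell_norm p x \<le> 1" "finite F"
  shows "(\<Sum>k\<in>F. \<bar>x k\<bar> powr p) \<le> 1"
proof -
  have "(\<Sum>k\<in>F. \<bar>x k\<bar> powr p) \<le> (\<Sum>n. \<bar>x n\<bar> powr p)"
    using assms by (intro sum_le_suminf) (auto simp: ell_def)
  also have "\<dots> \<le> 1"
    using assms ell_norm_le_iff[of p 1 x] by simp
  finally show ?thesis .
qed

lemma ell_tendsto_zero:
  assumes "0 < p" "x \<in> ell p"
  shows "x \<longlonglongrightarrow> 0"
proof -
  have "(\<lambda>n. \<bar>x n\<bar> powr p) \<longlonglongrightarrow> 0"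
    using assms by (simp add: ell_def summable_LIMSEQ_zero)
  then have "(\<lambda>n. (\<bar>x n\<bar> powr p) powr (1/p)) \<longlonglongrightarrow> 0"
    by (rule tendsto_zero_powrI[where b="1/p"]) (use assms in auto)
  then have "(\<lambda>n. \<bar>x n\<bar>) \<longlonglongrightarrow> 0"
    using assms by (simp add: powr_powr)
  then show ?thesis
    by (simp only: tendsto_rabs_zero_iff)
qed

lemma powr_convex_nonneg:
  fixes a b t q :: real
  assumes "1 \<le> q" "0 \<le> a" "0 \<le> b" "0 \<le> t" "t \<le> 1"
  shows "((1 - t) * a + t * b) powr q \<le> (1 - t) * a powr q + t * b powr q"
proof -
  \<comment> \<open>Covers the endpoint 0 of the half-line: if \<open>a\<close> or \<open>b\<close>
    vanishes, the claim reduces to this, which holds since \<open>s powr q \<le> s\<close> for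
    \<open>s\<close> in (0, 1].\<close>
  have contract: "(s * c) powr q \<le> s * c powr q" if "0 \<le> s" "s \<le> 1" "0 \<le> c" for s c :: real
  proof (cases "s = 0")
    case False
    then have "s powr q \<le> s powr 1"
      using that assms(1) by (intro powr_mono') auto
    then show ?thesis
      using that False by (simp add: powr_mult mult_right_mono)
  qed simp
  show ?thesis
  proof (cases "a = 0 \<or> b = 0")
    case True
    then show ?thesis
      using contract[of t b] contract[of "1 - t" a] assms by auto
  next
    case False
    then show ?thesis
      using convex_onD[OF powr_convex[OF assms(1)], of t a b] assms by simp
  qed
qed

text \<open>Minkowski's inequality by convexity: \<open>(|x n| + |y n|) / (A + B)\<close> is the
  convex combination of \<open>|x n| / A\<close> and \<open>|y n| / B\<close> with weights
  \<open>1 - t\<close> and \<open>t\<close>. Positive bounds \<open>A\<close>, \<open>B\<close>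
  stand in for the norms, which may vanish; letting them approach the norms gives the triangle
  inequality.\<close>

lemma ell_add_aux:
  assumes q: "1 \<le> q" and x: "x \<in> ell q" and y: "y \<in> ell q"
    and A: "0 < A" "ell_norm q x \<le> A" and B: "0 < B" "ell_norm q y \<le> B"
  shows "(\<lambda>n. x n + y n) \<in> ell q \<and> ell_norm q (\<lambda>n. x n + y n) \<le> A + B"
proof -
  define t where "t = B / (A + B)"
  have t: "0 \<le> t" "t \<le> 1" "1 - t = A / (A + B)"
    using A B by (auto simp: t_def field_simps)
  define g where "g n = (A + B) powr q *
      ((1 - t) * (\<bar>x n\<bar> powr q / A powr q) + t * (\<bar>y n\<bar> powr q / B powr q))" for n
  have le: "\<bar>x n + y n\<bar> powr q \<le> g n" for n
  proof -
    have "(1 - t) * (\<bar>x n\<bar> / A) + t * (\<bar>y n\<bar> / B) = (\<bar>x n\<bar> + \<bar>y n\<bar>) / (A + B)"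
      using A B by (simp add: t(3)) (simp add: t_def add_divide_distrib)
    then have eq: "\<bar>x n\<bar> + \<bar>y n\<bar> = (A + B) * ((1 - t) * (\<bar>x n\<bar> / A) + t * (\<bar>y n\<bar> / B))"
      using A B by simp
    have "\<bar>x n + y n\<bar> powr q \<le> (\<bar>x n\<bar> + \<bar>y n\<bar>) powr q"
      using q by (intro powr_mono2) auto
    also have "\<dots> = (A + B) powr q * ((1 - t) * (\<bar>x n\<bar> / A) + t * (\<bar>y n\<bar> / B)) powr q"
      unfolding eq using A B t by (intro powr_mult)
    also have "\<dots> \<le> (A + B) powr q *
        ((1 - t) * (\<bar>x n\<bar> / A) powr q + t * (\<bar>y n\<bar> / B) powr q)"
      using A B t q by (intro mult_left_mono powr_convex_nonneg) auto
    also have "\<dots> = g n"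
      using A B by (simp add: g_def powr_divide)
    finally show ?thesis .
  qed
  have sx: "summable (\<lambda>n. \<bar>x n\<bar> powr q)" and sy: "summable (\<lambda>n. \<bar>y n\<bar> powr q)"
    using x y by (auto simp: ell_def)
  have sg: "g sums ((A + B) powr q * ((1 - t) * ((\<Sum>n. \<bar>x n\<bar> powr q) / A powr q)
      + t * ((\<Sum>n. \<bar>y n\<bar> powr q) / B powr q)))"
    unfolding g_def
    by (intro sums_mult sums_add sums_divide summable_sums sx sy)
  have s: "summable (\<lambda>n. \<bar>x n + y n\<bar> powr q)"
    by (rule summable_comparison_test'[OF sums_summable[OF sg], of 0]) (use le in auto)
  then have mem: "(\<lambda>n. x n + y n) \<in> ell q" by (simp add: ell_def)
  have "(\<Sum>n. \<bar>x n + y n\<bar> powr q) \<le> suminf g"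
    by (intro suminf_le le s sums_summable[OF sg])
  also have "\<dots> \<le> (A + B) powr q * ((1 - t) * 1 + t * 1)"
    unfolding sums_unique[OF sg, symmetric]
    using A B x y q t
    by (intro mult_left_mono add_mono) (auto simp: ell_norm_le_iff)
  finally have "(\<Sum>n. \<bar>x n + y n\<bar> powr q) \<le> (A + B) powr q" by simp
  then show ?thesis
    using mem q A B by (simp add: ell_norm_le_iff)
qed

lemma ell_add:
  assumes "1 \<le> q" "x \<in> ell q" "y \<in> ell q"
  shows "(\<lambda>n. x n + y n) \<in> ell q"
  using ell_add_aux[OF assms, of "ell_norm q x + 1" "ell_norm q y + 1"]
  by (simp add: ell_norm_nonneg add_nonneg_pos)

lemma ell_norm_triangle:
  assumes "1 \<le> q" "x \<in> ell q" "y \<in> ell q"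
  shows "ell_norm q (\<lambda>n. x n + y n) \<le> ell_norm q x + ell_norm q y"
proof (rule field_le_epsilon)
  fix e :: real assume "0 < e"
  then show "ell_norm q (\<lambda>n. x n + y n) \<le> ell_norm q x + ell_norm q y + e"
    using ell_add_aux[OF assms, of "ell_norm q x + e/2" "ell_norm q y + e/2"]
    by (simp add: ell_norm_nonneg add_nonneg_pos)
qed

subsection \<open>Nonincreasing rearrangements\<close>

lemma noninc_perm_nonneg:
  assumes "\<alpha> \<longlonglongrightarrow> 0"
  shows "0 \<le> noninc_perm \<alpha> k"
proof -
  obtain F where "finite F" "noninc_perm \<alpha> k = (SUP j\<in>- F. \<bar>\<alpha> j\<bar>)"
    using noninc_perm_attained[OF assms] by metis
  then obtain i where "noninc_perm \<alpha> k = \<bar>\<alpha> i\<bar>"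
    using sup_compl_attained[OF assms] by metis
  then show ?thesis by simp
qed

lemma decseq_noninc_perm:
  assumes "\<alpha> \<longlonglongrightarrow> 0"
  shows "decseq (noninc_perm \<alpha>)"
proof (rule decseq_SucI)
  fix k
  obtain F where F: "finite F" "card F = k" "noninc_perm \<alpha> k = (SUP j\<in>- F. \<bar>\<alpha> j\<bar>)"
    using noninc_perm_attained[OF assms] by metis
  obtain i where i: "i \<in> - F" "(SUP j\<in>- F. \<bar>\<alpha> j\<bar>) = \<bar>\<alpha> i\<bar>" "\<forall>j\<in>- F. \<bar>\<alpha> j\<bar> \<le> \<bar>\<alpha> i\<bar>"
    using sup_compl_attained[OF assms F(1)] by blast
  have G: "finite (insert i F)" "card (insert i F) = Suc k"
    using F i by auto
  obtain m where m: "m \<in> - insert i F" "(SUP j\<in>- insert i F. \<bar>\<alpha> j\<bar>) = \<bar>\<alpha> m\<bar>"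
    using sup_compl_attained[OF assms G(1)] by blast
  have "noninc_perm \<alpha> (Suc k) \<le> \<bar>\<alpha> m\<bar>"
    using noninc_perm_attained[OF assms, of "Suc k"] G m by metis
  also have "\<dots> \<le> noninc_perm \<alpha> k"
    using F i m by simp
  finally show "noninc_perm \<alpha> (Suc k) \<le> noninc_perm \<alpha> k" .
qed

text \<open>\<open>F\<close> grows greedily: any \<open>F\<close> of cardinality \<open>K\<close>
  competes in the infimum \<open>noninc_perm \<alpha> K\<close>, which is therefore at most the
  largest \<open>|\<alpha> m|\<close> off \<open>F\<close>; this \<open>m\<close> is the index to
  add.\<close>

lemma noninc_perm_sum_le:
  assumes "\<alpha> \<longlonglongrightarrow> 0" "0 < p"
  shows "\<exists>F. finite F \<and> card F = K \<and>
    (\<Sum>k<K. noninc_perm \<alpha> k powr p) \<le> (\<Sum>j\<in>F. \<bar>\<alpha> j\<bar> powr p)"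
proof (induction K)
  case 0
  show ?case by (intro exI[of _ "{}"]) simp
next
  case (Suc K)
  then obtain F where F: "finite F" "card F = K"
    "(\<Sum>k<K. noninc_perm \<alpha> k powr p) \<le> (\<Sum>j\<in>F. \<bar>\<alpha> j\<bar> powr p)" by blast
  obtain m where m: "m \<in> - F" "(SUP j\<in>- F. \<bar>\<alpha> j\<bar>) = \<bar>\<alpha> m\<bar>"
    using sup_compl_attained[OF assms(1) F(1)] by blast
  have "noninc_perm \<alpha> K \<le> \<bar>\<alpha> m\<bar>"
    using noninc_perm_attained[OF assms(1), of K] F m by metis
  then have "noninc_perm \<alpha> K powr p \<le> \<bar>\<alpha> m\<bar> powr p"
    using assms noninc_perm_nonneg by (intro powr_mono2) auto
  with F m(1) have "finite (insert m F) \<and> card (insert m F) = Suc K \<and>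
    (\<Sum>k<Suc K. noninc_perm \<alpha> k powr p) \<le> (\<Sum>j\<in>insert m F. \<bar>\<alpha> j\<bar> powr p)"
    by simp
  then show ?case by blast
qed

lemma noninc_perm_unit_ball:
  assumes "0 < p" "x \<in> ell p" "ell_norm p x \<le> 1"
  shows "noninc_perm x \<in> ell p" "ell_norm p (noninc_perm x) \<le> 1"
proof -
  have x0: "x \<longlonglongrightarrow> 0" using ell_tendsto_zero assms by blast
  have "(\<Sum>k<K. \<bar>noninc_perm x k\<bar> powr p) \<le> 1" for K
  proof -
    obtain F where F: "finite F" "(\<Sum>k<K. noninc_perm x k powr p) \<le> (\<Sum>j\<in>F. \<bar>x j\<bar> powr p)"
      using noninc_perm_sum_le[OF x0 assms(1)] by blast
    show ?thesis
      using F(2) ell_sum_le_one[OF assms F(1)] by (simp add: noninc_perm_nonneg[OF x0])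
  qed
  then show "noninc_perm x \<in> ell p" "ell_norm p (noninc_perm x) \<le> 1"
    using ell_bounded_partial_sums[OF assms(1)] by blast+
qed

text \<open>The first \<open>k + 1\<close> terms of the power sum are each at least
  \<open>y k powr p\<close>, and together they are at most 1.\<close>

lemma decreasing_unit_ball_decay:
  assumes p: "0 < p" and y: "y \<in> ell p" "ell_norm p y \<le> 1" and d: "decseq y" "\<And>k. 0 \<le> y k"
  shows "y k \<le> real (Suc k) powr (- (1 / p))"
proof -
  have "real (Suc k) * y k powr p = (\<Sum>j<Suc k. y k powr p)" by simp
  also have "\<dots> \<le> (\<Sum>j<Suc k. \<bar>y j\<bar> powr p)"
    using p d by (intro sum_mono powr_mono2) (auto simp: decseq_def)
  also have "\<dots> \<le> 1" using ell_sum_le_one[OF p y] by blast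
  finally have "y k powr p \<le> real (Suc k) powr (-1)"
    by (simp add: powr_minus field_simps del: of_nat_Suc)
  then have "(y k powr p) powr (1/p) \<le> (real (Suc k) powr (-1)) powr (1/p)"
    using p by (intro powr_mono2) auto
  then show ?thesis
    unfolding powr_powr using p d by simp
qed

subsection \<open>Maximizing sequences\<close>

text \<open>\<open>Sup\<close> on the reals is informative only for nonempty sets that are bounded
  above; nonemptiness comes from \<open>unit_vector\<close>.\<close>

lemma bdd_above_op_norm:
  assumes "ell_bounded_linear p q T"
  shows "bdd_above {ell_norm q (T x) |x. x \<in> ell p \<and> ell_norm p x = 1}"
proof -
  obtain C where "\<And>x. x \<in> ell p \<Longrightarrow> ell_norm q (T x) \<le> C * ell_norm p x"
    using assms by (auto simp: ell_bounded_linear_def)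
  then show ?thesis
    by (intro bdd_aboveI[where M=C]) force
qed

lemma ell_norm_le_op_norm:
  assumes p: "0 < p" and q: "0 < q" and T: "ell_bounded_linear p q T" and x: "x \<in> ell p"
  shows "ell_norm q (T x) \<le> op_norm p q T * ell_norm p x"
proof (cases "ell_norm p x = 0")
  case True
  \<comment> \<open>Such an \<open>x\<close> cannot be normalized, but any bound \<open>C\<close>
    already forces the norm of \<open>T x\<close> to be at most 0.\<close>
  obtain C where "ell_norm q (T x) \<le> C * ell_norm p x"
    using T x by (auto simp: ell_bounded_linear_def)
  then show ?thesis using True by simp
next
  case False
  define a where "a = ell_norm p x"
  have a: "0 < a" using False ell_norm_nonneg[of p x] by (simp add: a_def)
  let ?u = "\<lambda>n. (1 / a) * x n"
  have "ell_norm p ?u = \<bar>1 / a\<bar> * ell_norm p x"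
    by (rule ell_norm_scale[OF p x])
  then have u: "?u \<in> ell p" "ell_norm p ?u = 1"
    using a ell_scale[OF x, of "1 / a"] by (simp_all flip: a_def)
  have Tx: "T x \<in> ell q" and Tu: "T ?u = (\<lambda>n. (1 / a) * T x n)"
    using T x unfolding ell_bounded_linear_def ell_linear_def by blast+
  have "ell_norm q (T ?u) \<le> op_norm p q T"
    unfolding op_norm_def by (rule cSup_upper[OF _ bdd_above_op_norm[OF T]]) (use u in blast)
  moreover have "ell_norm q (T ?u) = (1 / a) * ell_norm q (T x)"
    unfolding Tu using ell_norm_scale[OF q Tx, of "1 / a"] a by simp
  ultimately have "ell_norm q (T x) / a \<le> op_norm p q T" by simp
  then show ?thesis using a by (simp only: pos_divide_le_eq flip: a_def)
qed

lemma unit_vector: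
  shows "(\<lambda>n. if n = 0 then 1 else 0) \<in> ell p"
    and "ell_norm p (\<lambda>n. if n = 0 then 1 else 0) = 1"
proof -
  have "(\<lambda>n::nat. \<bar>if n = 0 then 1 else 0 :: real\<bar> powr p) = (\<lambda>n. if n = 0 then 1 else 0)" by auto
  then have "(\<lambda>n::nat. \<bar>if n = 0 then 1 else 0 :: real\<bar> powr p) sums 1"
    using sums_single[of 0 "\<lambda>_. 1::real"] by simp
  then show "(\<lambda>n. if n = 0 then 1 else 0) \<in> ell p"
    "ell_norm p (\<lambda>n. if n = 0 then 1 else 0) = 1"
    unfolding ell_def ell_norm_def sums_iff by simp_all
qed

lemma almost_norming_decreasing:
  assumes p: "0 < p" and T: "ell_bounded_linear p q T" and M: "perm_monotone p q T"
    and e: "0 < e"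
  shows "\<exists>y\<in>ell p. ell_norm p y \<le> 1 \<and> decseq y \<and> (\<forall>k. 0 \<le> y k) \<and>
    op_norm p q T - e < ell_norm q (T y)"
proof -
  let ?S = "{ell_norm q (T x) |x. x \<in> ell p \<and> ell_norm p x = 1}"
  have "?S \<noteq> {}" using unit_vector by blast
  then obtain s where "s \<in> ?S" "op_norm p q T - e < s"
    using less_cSup_iff[OF _ bdd_above_op_norm[OF T], of "op_norm p q T - e"] e
    by (auto simp: op_norm_def)
  then obtain x where x: "x \<in> ell p" "ell_norm p x = 1" "op_norm p q T - e < ell_norm q (T x)"
    by blast
  have "ell_norm q (T x) \<le> ell_norm q (T (noninc_perm x))"
    using M x by (auto simp: perm_monotone_def)
  moreover have "x \<longlonglongrightarrow> 0" using ell_tendsto_zero p x by blast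
  ultimately show ?thesis
    using x noninc_perm_unit_ball[OF p x(1)] decseq_noninc_perm noninc_perm_nonneg
    by (intro bexI[of _ "noninc_perm x"] conjI allI) simp_all
qed

text \<open>The common envelope \<open>b\<close> prevents mass from escaping to infinity in the
  \<open>r\<close>-norm. In the \<open>p\<close>-norm this fails: \<open>n powr (-1/p)\<close> on
  the first \<open>n\<close> indices has norm 1 and tends to 0 coordinatewise.\<close>

lemma decreasing_unit_ball_compact:
  assumes p: "0 < p" and r: "p < r"
    and y: "\<And>n. y n \<in> ell p" "\<And>n. ell_norm p (y n) \<le> 1"
    and d: "\<And>n. decseq (y n)" "\<And>n k. 0 \<le> y n k"
  obtains v \<phi> where "strict_mono (\<phi> :: nat \<Rightarrow> nat)" "v \<in> ell p" "ell_norm p v \<le> 1"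
    "(\<lambda>n. ell_norm r (\<lambda>k. y (\<phi> n) k - v k)) \<longlonglongrightarrow> 0"
proof -
  define b where "b k = real (Suc k) powr (- (1 / p))" for k
  have yb: "y n k \<le> b k" for n k
    unfolding b_def by (rule decreasing_unit_ball_decay[OF p y d])
  have b1: "b k \<le> 1" for k
    unfolding b_def using p powr_mono[of "- (1 / p)" 0 "real (Suc k)"] by simp
  \<comment> \<open>One bound for all coordinates, as input to the diagonal argument.\<close>
  have "norm (y n k) \<le> 1" for n k
    using yb[of n k] b1[of k] d(2)[of n k] by simp
  then obtain \<phi> :: "nat \<Rightarrow> nat" where \<phi>: "strict_mono \<phi>" "\<And>k. \<exists>l. (\<lambda>n. y (\<phi> n) k) \<longlonglongrightarrow> l"
    using function_convergent_subsequence[of UNIV y 1] by (metis UNIV_I uncountable_def countableI_type)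
  then obtain v where v: "\<And>k. (\<lambda>n. y (\<phi> n) k) \<longlonglongrightarrow> v k" by metis
  have v0: "0 \<le> v k" and vb: "v k \<le> b k" for k
    using LIMSEQ_le_const[OF v] LIMSEQ_le_const2[OF v] d(2) yb by blast+
  \<comment> \<open>Fatou's lemma for series: each finite partial sum passes to the limit and keeps
    the bound 1.\<close>
  have "(\<Sum>k<K. \<bar>v k\<bar> powr p) \<le> 1" for K
  proof (rule LIMSEQ_le_const2)
    show "(\<lambda>n. \<Sum>k<K. \<bar>y (\<phi> n) k\<bar> powr p) \<longlonglongrightarrow> (\<Sum>k<K. \<bar>v k\<bar> powr p)"
      using p by (intro tendsto_sum tendsto_powr' tendsto_rabs v tendsto_const) auto
    show "\<exists>N. \<forall>n\<ge>N. (\<Sum>k<K. \<bar>y (\<phi> n) k\<bar> powr p) \<le> 1"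
      using ell_sum_le_one[OF p y] by blast
  qed
  note vball = ell_bounded_partial_sums[OF p this]
  have lim0: "(\<lambda>n. \<bar>y (\<phi> n) k - v k\<bar> powr r) \<longlonglongrightarrow> 0" for k
  proof (rule tendsto_zero_powrI[where b=r])
    show "(\<lambda>n. \<bar>y (\<phi> n) k - v k\<bar>) \<longlonglongrightarrow> 0"
      using v[of k] by (simp add: LIM_zero tendsto_rabs_zero)
  qed (use p r in auto)
  have dom: "norm (\<bar>y (\<phi> n) k - v k\<bar> powr r) \<le> b k powr r" for n k
  proof -
    \<comment> \<open>Both entries lie in the interval from 0 to \<open>b k\<close>, so no factor 2
      arises.\<close>
    have "\<bar>y (\<phi> n) k - v k\<bar> \<le> b k"
      using yb[of "\<phi> n" k] d(2)[of "\<phi> n" k] v0[of k] vb[of k] by (auto simp: abs_le_iff)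
    then show ?thesis using p r by (simp add: powr_mono2)
  qed
  \<comment> \<open>Up to an index shift this is the series of \<open>b k powr r\<close>; it
    converges because \<open>r / p > 1\<close>.\<close>
  have "summable (\<lambda>k. real k powr (- (r / p)))"
    using p r by (subst summable_real_powr_iff) (simp add: field_simps)
  then have sb: "summable (\<lambda>k. b k powr r)"
    unfolding b_def by (subst (asm) summable_Suc_iff[symmetric]) (simp add: powr_powr)
  have "summable (\<lambda>k. \<bar>y (\<phi> n) k - v k\<bar> powr r)" for n
    by (rule summable_comparison_test'[OF sb, of 0]) (rule dom)
  then have nonneg: "0 \<le> (\<Sum>k. \<bar>y (\<phi> n) k - v k\<bar> powr r)" for n
    by (intro suminf_nonneg) auto
  \<comment> \<open>Tannery's theorem is dominated convergence for series.\<close>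
  have "(\<lambda>n. \<Sum>k. \<bar>y (\<phi> n) k - v k\<bar> powr r) \<longlonglongrightarrow> (\<Sum>k. 0)"
    using sb tannerys_theorem[where a="\<lambda>k n. \<bar>y (\<phi> n) k - v k\<bar> powr r" and b="\<lambda>_. 0"
      and F=sequentially and M="\<lambda>k. b k powr r", OF lim0 always_eventually] dom by auto
  then have "(\<lambda>n. ell_norm r (\<lambda>k. y (\<phi> n) k - v k)) \<longlonglongrightarrow> 0"
    unfolding ell_norm_def by (intro tendsto_zero_powrI[where b="1/r"]) (use p r nonneg in auto)
  then show thesis using that \<phi>(1) vball by blast
qed

theorem theorem4:
  fixes p q \<epsilon> :: real and T :: "(nat \<Rightarrow> real) \<Rightarrow> (nat \<Rightarrow> real)"
  assumes "1 < p" and "1 \<le> q"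
    and "ell_bounded_linear p q T"
    and "perm_monotone p q T"
    and "\<epsilon> > 0"
    and "\<exists>C. \<forall>x\<in>ell p. ell_norm q (T x) \<le> C * ell_norm (p + \<epsilon>) x"
  shows "\<exists>v\<in>ell p. ell_norm p v = 1 \<and> ell_norm q (T v) = op_norm p q T"
proof -
  define M where "M = op_norm p q T"
  have p: "0 < p" and q: "0 < q" using assms by auto
  note upper = ell_norm_le_op_norm[OF p q assms(3), folded M_def]
  have add: "T (\<lambda>n. x n + y n) = (\<lambda>n. T x n + T y n)" if "x \<in> ell p" "y \<in> ell p" for x y
    using assms(3) that by (simp add: ell_bounded_linear_def ell_linear_def)
  have Tq: "T x \<in> ell q" if "x \<in> ell p" for x
    using assms(3) that by (simp add: ell_bounded_linear_def ell_linear_def)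
  obtain C where C: "\<And>x. x \<in> ell p \<Longrightarrow> ell_norm q (T x) \<le> C * ell_norm (p + \<epsilon>) x"
    using assms(6) by blast
  have "\<exists>y\<in>ell p. ell_norm p y \<le> 1 \<and> decseq y \<and> (\<forall>k. 0 \<le> y k) \<and>
      M - inverse (real (Suc n)) < ell_norm q (T y)" for n
    unfolding M_def by (intro almost_norming_decreasing p assms) simp
  then obtain y where y: "\<And>n. y n \<in> ell p" "\<And>n. ell_norm p (y n) \<le> 1" "\<And>n. decseq (y n)"
    "\<And>n k. 0 \<le> y n k" "\<And>n. M - inverse (real (Suc n)) < ell_norm q (T (y n))"
    by metis
  obtain v \<phi> where \<phi>: "strict_mono (\<phi> :: nat \<Rightarrow> nat)" and v: "v \<in> ell p" "ell_norm p v \<le> 1"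
    and lim: "(\<lambda>n. ell_norm (p + \<epsilon>) (\<lambda>k. y (\<phi> n) k - v k)) \<longlonglongrightarrow> 0"
    by (rule decreasing_unit_ball_compact[where r = "p + \<epsilon>" and y = y, OF p _ y(1-4)])
      (use assms(5) in auto)
  \<comment> \<open>The estimate by the \<open>p + \<epsilon>\<close> norm is applied to the
    difference \<open>?z\<close>, which still lies in \<open>ell p\<close>.\<close>
  have bound: "M - inverse (real (Suc (\<phi> n)))
      \<le> C * ell_norm (p + \<epsilon>) (\<lambda>k. y (\<phi> n) k - v k) + ell_norm q (T v)" for n
  proof -
    let ?z = "\<lambda>k. y (\<phi> n) k - v k"
    have z: "?z \<in> ell p"
      using ell_add[of p "y (\<phi> n)" "\<lambda>k. (-1) * v k"] ell_scale[OF v(1), of "-1"] y(1) assms(1)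
      by simp
    have "T (y (\<phi> n)) = (\<lambda>k. T ?z k + T v k)"
      using add[OF z v(1)] by simp
    then have "ell_norm q (T (y (\<phi> n))) \<le> ell_norm q (T ?z) + ell_norm q (T v)"
      using ell_norm_triangle[OF assms(2) Tq[OF z] Tq[OF v(1)]] by simp
    then show ?thesis using C[OF z] y(5)[of "\<phi> n"] by linarith
  qed
  have "(\<lambda>n. M - inverse (real (Suc (\<phi> n)))) \<longlonglongrightarrow> M - 0"
    using LIMSEQ_subseq_LIMSEQ[OF LIMSEQ_inverse_real_of_nat \<phi>]
    by (intro tendsto_diff tendsto_const) (simp add: o_def)
  moreover have "(\<lambda>n. C * ell_norm (p + \<epsilon>) (\<lambda>k. y (\<phi> n) k - v k) + ell_norm q (T v))
      \<longlonglongrightarrow> C * 0 + ell_norm q (T v)"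
    by (intro tendsto_intros lim)
  ultimately have MTv: "M \<le> ell_norm q (T v)"
    using LIMSEQ_le bound by fastforce
  have Mv: "ell_norm q (T v) \<le> M * ell_norm p v" by (rule upper[OF v(1)])
  show ?thesis
  proof (cases "M \<le> 0")
    \<comment> \<open>The norm of \<open>T ?e\<close> lies between 0 and \<open>M\<close>, so
      \<open>M = 0\<close> and the unit vector \<open>?e\<close> is norming.\<close>
    case True
    let ?e = "\<lambda>n::nat. if n = 0 then 1 else 0 :: real"
    have "0 \<le> ell_norm q (T ?e)" "ell_norm q (T ?e) \<le> M"
      using upper[OF unit_vector(1)] by (auto simp: unit_vector(2) ell_norm_nonneg)
    then show ?thesis
      using True unit_vector by (intro bexI[of _ ?e]) (simp_all flip: M_def)
  next
    case False
    \<comment> \<open>Cancelling the positive factor \<open>M\<close> excludes a loss of norm in the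
      limit \<open>v\<close>.\<close>
    moreover have "M * 1 \<le> M * ell_norm p v" using MTv Mv by simp
    ultimately have "1 \<le> ell_norm p v" by simp
    then have "ell_norm p v = 1" using v(2) by simp
    then show ?thesis using MTv Mv v(1) by (intro bexI[of _ v]) (simp_all flip: M_def)
  qed
qed

end
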